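(* Let $1\to G_1\to G\to G_0\to 1$ be an exact sequence of groups. Let $1\to \Gamma_1\to\Gamma\to\Gamma_0\to 1$ be an exact sequence of (not necessarily abelian) groups with $\Gamma_1$ central in $\Gamma$, where $\Gamma_1,\Gamma,\Gamma_0$ are $G$-groups on which $G$ acts by group automorphisms through its quotient $G_0=G/G_1$ and the maps are $G$-equivariant. Let $\pi_1\in \mathrm{Hom}(G_1,\Gamma_1)^G$ and $\pi_0\in Z^1(G_0,\Gamma_0)$. Then there exists a 1-cocycle $\pi\in Z^1(G,\Gamma)$ which lifts the pair $(\pi_1,\pi_0)$ if and only if $$\mathrm{Tra}(\pi_1)^{-1}=\Delta([\pi_0])\quad\text{in } H^2(G_0,\Gamma_1).$$
   Context: Regard $G_1$ as a normal subgroup of $G$ and $\Gamma_1$ as a subgroup of $\Gamma$. Groups are written multiplicatively. Non-abelian 1-cocycles: for a group $H$ acting on a (possibly non-abelian) group $M$ by automorphisms, $Z^1(H,M)$ is the set of maps $\pi:H\to M$ with $\pi(gh)=\pi(g)\cdot g(\pi(h))$ for all $g,h\in H$. $H^1(H,M)$ is the usual pointed set of classes of 1-cocycles, where $\pi\sim\pi'$ if there is $m\in M$ with $\pi'(g)=m^{-1}\pi(g)\,g(m)$ for all $g\in H$. $\mathrm{Hom}(G_1,\Gamma_1)^G$ is the set of group homomorphisms $\pi_1:G_1\to\Gamma_1$ with $\pi_1(n)=g(\pi_1(g^{-1}ng))$ for all $g\in G$, $n\in G_1$. Lifting: a 1-cocycle $\pi\in Z^1(G,\Gamma)$ lifts the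 pair $(\pi_1,\pi_0)$ if $\pi(G_1)\subset\Gamma_1$, the restriction of $\pi$ to $G_1$ is $\pi_1$, and $\pi_0(gG_1)=\pi(g)\Gamma_1$ for all $g\in G$. Transgression $\mathrm{Tra}:\mathrm{Hom}(G_1,\Gamma_1)^G\to H^2(G_0,\Gamma_1)$: choose a set-theoretic section $g\mapsto\overline g$ of $G\to G_0$ and put $\beta(g_1,g_2)=\overline{g_1}\,\overline{g_2}\,(\overline{g_1g_2})^{-1}\in G_1$. Then $\mathrm{Tra}(\pi_1)$ is the class of the 2-cocycle $(g_1,g_2)\mapsto \pi_1(\beta(g_1,g_2))^{-1}$. Coboundary map $\Delta:H^1(G_0,\Gamma_0)\to H^2(G_0,\Gamma_1)$ (a map of pointed sets): choose a set-theoretic section $\gamma\mapsto\overline\gamma$ of $\Gamma\to\Gamma_0$. Then $\Delta([\pi_0])$ is the class of the 2-cocycle $(g_1,g_2)\mapsto\overline{\pi_0(g_1)}\cdot g_1\bigl(\overline{\pi_0(g_2)}\bigr)\cdot\bigl(\overline{\pi_0(g_1g_2)}\bigr)^{-1}\in\Gamma_1$. Both classes are independent of the chosen sections, and $\Delta([\pi_0])$ depends only on the class of $\pi_0$. *)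

theory Defs
  imports "HOL-Algebra.Algebra"
begin

text \<open>
  An action of a group \<open>H\<close> on a group \<open>M\<close> by automorphisms is a homomorphism
  \<open>a\<close> from \<open>H\<close> to \<^const>\<open>AutoGroup\<close> \<open>M\<close>. Cochains are extensional functions, so that
  equality of cochains is equality on the carriers.
\<close>

section \<open>Non-abelian first cohomology\<close>

definition Z1 :: "('h, 'x) monoid_scheme \<Rightarrow> ('m, 'y) monoid_scheme \<Rightarrow> ('h \<Rightarrow> 'm \<Rightarrow> 'm) \<Rightarrow> ('h \<Rightarrow> 'm) set"
  where "Z1 H M a = {c \<in> carrier H \<rightarrow>\<^sub>E carrier M.
    \<forall>g\<in>carrier H. \<forall>h\<in>carrier H. c (g \<otimes>\<^bsub>H\<^esub> h) = c g \<otimes>\<^bsub>M\<^esub> a g (c h)}"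

definition Z1_rel :: "('h, 'x) monoid_scheme \<Rightarrow> ('m, 'y) monoid_scheme \<Rightarrow> ('h \<Rightarrow> 'm \<Rightarrow> 'm) \<Rightarrow> (('h \<Rightarrow> 'm) \<times> ('h \<Rightarrow> 'm)) set"
  where "Z1_rel H M a = {(c, c'). c \<in> Z1 H M a \<and> c' \<in> Z1 H M a \<and>
    (\<exists>m\<in>carrier M. \<forall>g\<in>carrier H. c' g = inv\<^bsub>M\<^esub> m \<otimes>\<^bsub>M\<^esub> c g \<otimes>\<^bsub>M\<^esub> a g m)}"

definition H1 :: "('h, 'x) monoid_scheme \<Rightarrow> ('m, 'y) monoid_scheme \<Rightarrow> ('h \<Rightarrow> 'm \<Rightarrow> 'm) \<Rightarrow> ('h \<Rightarrow> 'm) set set"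
  where "H1 H M a = Z1 H M a // Z1_rel H M a"

definition H1_class :: "('h, 'x) monoid_scheme \<Rightarrow> ('m, 'y) monoid_scheme \<Rightarrow> ('h \<Rightarrow> 'm \<Rightarrow> 'm) \<Rightarrow> ('h \<Rightarrow> 'm) \<Rightarrow> ('h \<Rightarrow> 'm) set"
  where "H1_class H M a c = Z1_rel H M a `` {c}"


section \<open>Second cohomology with abelian coefficients\<close>

text \<open>The groups are those of the inhomogeneous standard complex, written multiplicatively.\<close>

definition Z2 :: "('h, 'x) monoid_scheme \<Rightarrow> ('m, 'y) monoid_scheme \<Rightarrow> ('h \<Rightarrow> 'm \<Rightarrow> 'm) \<Rightarrow> ('h \<times> 'h \<Rightarrow> 'm) monoid"
  where "Z2 H A a = \<lparr>
    carrier = {c \<in> carrier H \<times> carrier H \<rightarrow>\<^sub>E carrier A.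
      \<forall>g\<in>carrier H. \<forall>h\<in>carrier H. \<forall>k\<in>carrier H.
        a g (c (h, k)) \<otimes>\<^bsub>A\<^esub> c (g, h \<otimes>\<^bsub>H\<^esub> k) = c (g, h) \<otimes>\<^bsub>A\<^esub> c (g \<otimes>\<^bsub>H\<^esub> h, k)},
    monoid.mult = (\<lambda>c d. \<lambda>x\<in>carrier H \<times> carrier H. c x \<otimes>\<^bsub>A\<^esub> d x),
    monoid.one = (\<lambda>x\<in>carrier H \<times> carrier H. \<one>\<^bsub>A\<^esub>)\<rparr>"

definition coboundary :: "('h, 'x) monoid_scheme \<Rightarrow> ('m, 'y) monoid_scheme \<Rightarrow> ('h \<Rightarrow> 'm \<Rightarrow> 'm) \<Rightarrow> ('h \<Rightarrow> 'm) \<Rightarrow> ('h \<times> 'h \<Rightarrow> 'm)"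
  where "coboundary H M a f = (\<lambda>(g, h)\<in>carrier H \<times> carrier H.
    f g \<otimes>\<^bsub>M\<^esub> a g (f h) \<otimes>\<^bsub>M\<^esub> inv\<^bsub>M\<^esub> f (g \<otimes>\<^bsub>H\<^esub> h))"

definition B2 :: "('h, 'x) monoid_scheme \<Rightarrow> ('m, 'y) monoid_scheme \<Rightarrow> ('h \<Rightarrow> 'm \<Rightarrow> 'm) \<Rightarrow> ('h \<times> 'h \<Rightarrow> 'm) set"
  where "B2 H A a = coboundary H A a ` (carrier H \<rightarrow> carrier A)"

definition H2 :: "('h, 'x) monoid_scheme \<Rightarrow> ('m, 'y) monoid_scheme \<Rightarrow> ('h \<Rightarrow> 'm \<Rightarrow> 'm) \<Rightarrow> ('h \<times> 'h \<Rightarrow> 'm) set monoid"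
  where "H2 H A a = Z2 H A a Mod B2 H A a"

definition H2_class :: "('h, 'x) monoid_scheme \<Rightarrow> ('m, 'y) monoid_scheme \<Rightarrow> ('h \<Rightarrow> 'm \<Rightarrow> 'm) \<Rightarrow> ('h \<times> 'h \<Rightarrow> 'm) \<Rightarrow> ('h \<times> 'h \<Rightarrow> 'm) set"
  where "H2_class H A a c = B2 H A a #>\<^bsub>Z2 H A a\<^esub> c"


section \<open>Transgression and the coboundary map\<close>

text \<open>
  The short exact sequences are given by a surjection \<open>p\<close> from \<open>G\<close> to \<open>G0\<close> whose kernel is the
  subset \<open>G1\<close> of \<open>G\<close>, and by a surjection \<open>q\<close> from \<open>Gam\<close> to \<open>Gam0\<close> whose kernel is the subset
  \<open>Gam1\<close> of \<open>Gam\<close>.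
  The coset of \<open>g\<close> modulo \<open>G1\<close> is thereby identified with \<open>p g\<close>, and that of \<open>x\<close> modulo \<open>Gam1\<close> with \<open>q x\<close>.
\<close>

definition set_section :: "('g, 'x) monoid_scheme \<Rightarrow> ('h, 'y) monoid_scheme \<Rightarrow> ('g \<Rightarrow> 'h) \<Rightarrow> ('h \<Rightarrow> 'g) \<Rightarrow> bool"
  where "set_section G H p s \<longleftrightarrow> s \<in> carrier H \<rightarrow> carrier G \<and> (\<forall>x\<in>carrier H. p (s x) = x)"

definition Hom_inv :: "('g, 'x) monoid_scheme \<Rightarrow> 'g set \<Rightarrow> ('m, 'y) monoid_scheme \<Rightarrow> ('g \<Rightarrow> 'm \<Rightarrow> 'm) \<Rightarrow> ('g \<Rightarrow> 'm) set"
  where "Hom_inv G G1 A b = {f \<in> hom (G\<lparr>carrier := G1\<rparr>) A.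
    \<forall>g\<in>carrier G. \<forall>n\<in>G1. f n = b g (f (inv\<^bsub>G\<^esub> g \<otimes>\<^bsub>G\<^esub> n \<otimes>\<^bsub>G\<^esub> g))}"

definition Tra_cocycle :: "('g, 'x) monoid_scheme \<Rightarrow> ('h, 'y) monoid_scheme \<Rightarrow> ('m, 'z) monoid_scheme \<Rightarrow>
    ('h \<Rightarrow> 'g) \<Rightarrow> ('g \<Rightarrow> 'm) \<Rightarrow> ('h \<times> 'h \<Rightarrow> 'm)"
  where "Tra_cocycle G G0 A s f = (\<lambda>(x, y)\<in>carrier G0 \<times> carrier G0.
    inv\<^bsub>A\<^esub> f (s x \<otimes>\<^bsub>G\<^esub> s y \<otimes>\<^bsub>G\<^esub> inv\<^bsub>G\<^esub> s (x \<otimes>\<^bsub>G0\<^esub> y)))"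

definition Tra :: "('g, 'x) monoid_scheme \<Rightarrow> ('h, 'y) monoid_scheme \<Rightarrow> ('g \<Rightarrow> 'h) \<Rightarrow>
    ('m, 'z) monoid_scheme \<Rightarrow> ('h \<Rightarrow> 'm \<Rightarrow> 'm) \<Rightarrow> ('g \<Rightarrow> 'm) \<Rightarrow> ('h \<times> 'h \<Rightarrow> 'm) set"
  where "Tra G G0 p A a f = H2_class G0 A a (Tra_cocycle G G0 A (SOME s. set_section G G0 p s) f)"

text \<open>
  \<open>Delta\<close> is defined on cohomology classes: it chooses a representing cocycle as well as a
  set-theoretic section. The lemmas \<open>Tra_eq\<close> and \<open>Delta_eq\<close> below show independence of all choices.
\<close>

definition Delta_cocycle :: "('h, 'x) monoid_scheme \<Rightarrow> ('m, 'y) monoid_scheme \<Rightarrow> ('h \<Rightarrow> 'm \<Rightarrow> 'm) \<Rightarrow>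
    ('n \<Rightarrow> 'm) \<Rightarrow> ('h \<Rightarrow> 'n) \<Rightarrow> ('h \<times> 'h \<Rightarrow> 'm)"
  where "Delta_cocycle G0 Gam a t c = (\<lambda>(x, y)\<in>carrier G0 \<times> carrier G0.
    t (c x) \<otimes>\<^bsub>Gam\<^esub> a x (t (c y)) \<otimes>\<^bsub>Gam\<^esub> inv\<^bsub>Gam\<^esub> t (c (x \<otimes>\<^bsub>G0\<^esub> y)))"

definition Delta :: "('h, 'x) monoid_scheme \<Rightarrow> ('m, 'y) monoid_scheme \<Rightarrow> ('n, 'z) monoid_scheme \<Rightarrow> ('m \<Rightarrow> 'n) \<Rightarrow>
    'm set \<Rightarrow> ('h \<Rightarrow> 'm \<Rightarrow> 'm) \<Rightarrow> ('h \<Rightarrow> 'm \<Rightarrow> 'm) \<Rightarrow> ('h \<Rightarrow> 'n) set \<Rightarrow> ('h \<times> 'h \<Rightarrow> 'm) set"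
  where "Delta G0 Gam Gam0 q Gam1 a a1 C = H2_class G0 (Gam\<lparr>carrier := Gam1\<rparr>) a1
    (Delta_cocycle G0 Gam a (SOME t. set_section Gam Gam0 q t) (SOME c. c \<in> C))"

definition lifts_pair :: "('g, 'x) monoid_scheme \<Rightarrow> 'g set \<Rightarrow> ('g \<Rightarrow> 'h) \<Rightarrow> 'm set \<Rightarrow> ('m \<Rightarrow> 'n) \<Rightarrow>
    ('g \<Rightarrow> 'm) \<Rightarrow> ('g \<Rightarrow> 'm) \<Rightarrow> ('h \<Rightarrow> 'n) \<Rightarrow> bool"
  where "lifts_pair G G1 p Gam1 q \<pi> \<pi>1 \<pi>0 \<longleftrightarrow>
    \<pi> ` G1 \<subseteq> Gam1 \<and> (\<forall>n\<in>G1. \<pi> n = \<pi>1 n) \<and> (\<forall>g\<in>carrier G. \<pi>0 (p g) = q (\<pi> g))"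


section \<open>Independence of choices\<close>

lemma hom_AutoGroupD:
  assumes "a \<in> hom H (AutoGroup M)" "group H" "group M" "g \<in> carrier H"
  shows "a g \<in> hom M M"
    and "x \<in> carrier M \<Longrightarrow> a g x \<in> carrier M"
    and "\<lbrakk>x \<in> carrier M; y \<in> carrier M\<rbrakk> \<Longrightarrow> a g (x \<otimes>\<^bsub>M\<^esub> y) = a g x \<otimes>\<^bsub>M\<^esub> a g y"
    and "x \<in> carrier M \<Longrightarrow> a g (inv\<^bsub>M\<^esub> x) = inv\<^bsub>M\<^esub> a g x"
    and "a g \<one>\<^bsub>M\<^esub> = \<one>\<^bsub>M\<^esub>"
    and "\<lbrakk>h \<in> carrier H; x \<in> carrier M\<rbrakk> \<Longrightarrow> a (g \<otimes>\<^bsub>H\<^esub> h) x = a g (a h x)"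
proof -
  have auto: "a k \<in> auto M" if "k \<in> carrier H" for k
    using hom_in_carrier[OF assms(1) that] by (simp add: AutoGroup_def)
  show hom: "a g \<in> hom M M"
    using auto[OF assms(4)] by (simp add: auto_def)
  interpret group_hom M M "a g"
    using assms hom by (simp add: group_hom_def group_hom_axioms_def)
  show "x \<in> carrier M \<Longrightarrow> a g x \<in> carrier M"
    and "\<lbrakk>x \<in> carrier M; y \<in> carrier M\<rbrakk> \<Longrightarrow> a g (x \<otimes>\<^bsub>M\<^esub> y) = a g x \<otimes>\<^bsub>M\<^esub> a g y"
    and "x \<in> carrier M \<Longrightarrow> a g (inv\<^bsub>M\<^esub> x) = inv\<^bsub>M\<^esub> a g x"
    and "a g \<one>\<^bsub>M\<^esub> = \<one>\<^bsub>M\<^esub>"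
    by auto
  assume h: "h \<in> carrier H" and x: "x \<in> carrier M"
  have "a (g \<otimes>\<^bsub>H\<^esub> h) = a g \<otimes>\<^bsub>AutoGroup M\<^esub> a h"
    using Group.hom_mult[OF assms(1,4) h] .
  then show "a (g \<otimes>\<^bsub>H\<^esub> h) x = a g (a h x)"
    using auto[OF assms(4)] auto[OF h] x
    by (simp add: AutoGroup_def BijGroup_def auto_def compose_def)
qed

locale coefficient_module = H: group H + A: comm_group A
  for H :: "('h, 'x) monoid_scheme" and A :: "('m, 'y) monoid_scheme"
    and a :: "'h \<Rightarrow> 'm \<Rightarrow> 'm" +
  assumes action: "a \<in> hom H (AutoGroup A)"
begin

lemmas act = hom_AutoGroupD(2-6)[OF action H.is_group A.is_group]

lemma Z2D:
  assumes "c \<in> carrier (Z2 H A a)" "g \<in> carrier H" "h \<in> carrier H"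
  shows "c (g, h) \<in> carrier A"
    and "k \<in> carrier H \<Longrightarrow>
      a g (c (h, k)) \<otimes>\<^bsub>A\<^esub> c (g, h \<otimes>\<^bsub>H\<^esub> k) = c (g, h) \<otimes>\<^bsub>A\<^esub> c (g \<otimes>\<^bsub>H\<^esub> h, k)"
  using assms by (auto simp: Z2_def PiE_iff)

lemma Z2I:
  assumes "c \<in> extensional (carrier H \<times> carrier H)"
    and "\<And>g h. \<lbrakk>g \<in> carrier H; h \<in> carrier H\<rbrakk> \<Longrightarrow> c (g, h) \<in> carrier A"
    and "\<And>g h k. \<lbrakk>g \<in> carrier H; h \<in> carrier H; k \<in> carrier H\<rbrakk> \<Longrightarrow>
      a g (c (h, k)) \<otimes>\<^bsub>A\<^esub> c (g, h \<otimes>\<^bsub>H\<^esub> k) = c (g, h) \<otimes>\<^bsub>A\<^esub> c (g \<otimes>\<^bsub>H\<^esub> h, k)"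
  shows "c \<in> carrier (Z2 H A a)"
  using assms by (auto simp: Z2_def PiE_iff)

lemma Z2_ext:
  assumes "c \<in> extensional (carrier H \<times> carrier H)" "d \<in> extensional (carrier H \<times> carrier H)"
    and "\<And>g h. \<lbrakk>g \<in> carrier H; h \<in> carrier H\<rbrakk> \<Longrightarrow> c (g, h) = d (g, h)"
  shows "c = d"
  using assms by (intro extensionalityI[of c "carrier H \<times> carrier H" d]) auto

lemma Z2_extensional: "c \<in> carrier (Z2 H A a) \<Longrightarrow> c \<in> extensional (carrier H \<times> carrier H)"
  by (auto simp: Z2_def PiE_iff)

lemma Z2_mult: "c \<otimes>\<^bsub>Z2 H A a\<^esub> d = (\<lambda>x\<in>carrier H \<times> carrier H. c x \<otimes>\<^bsub>A\<^esub> d x)"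
  and Z2_one: "\<one>\<^bsub>Z2 H A a\<^esub> = (\<lambda>x\<in>carrier H \<times> carrier H. \<one>\<^bsub>A\<^esub>)"
  by (simp_all add: Z2_def)

lemma comm_group_Z2: "comm_group (Z2 H A a)"
proof (rule comm_groupI)
  fix c d
  assume c: "c \<in> carrier (Z2 H A a)" and d: "d \<in> carrier (Z2 H A a)"
  show "c \<otimes>\<^bsub>Z2 H A a\<^esub> d \<in> carrier (Z2 H A a)"
  proof (rule Z2I)
    fix g h k assume ghk: "g \<in> carrier H" "h \<in> carrier H" "k \<in> carrier H"
    have "(a g (c (h, k)) \<otimes>\<^bsub>A\<^esub> a g (d (h, k))) \<otimes>\<^bsub>A\<^esub> (c (g, h \<otimes>\<^bsub>H\<^esub> k) \<otimes>\<^bsub>A\<^esub> d (g, h \<otimes>\<^bsub>H\<^esub> k))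
        = (a g (c (h, k)) \<otimes>\<^bsub>A\<^esub> c (g, h \<otimes>\<^bsub>H\<^esub> k)) \<otimes>\<^bsub>A\<^esub> (a g (d (h, k)) \<otimes>\<^bsub>A\<^esub> d (g, h \<otimes>\<^bsub>H\<^esub> k))"
      using ghk by (simp add: A.m_ac act Z2D(1)[OF c] Z2D(1)[OF d])
    also have "\<dots> = (c (g, h) \<otimes>\<^bsub>A\<^esub> c (g \<otimes>\<^bsub>H\<^esub> h, k)) \<otimes>\<^bsub>A\<^esub> (d (g, h) \<otimes>\<^bsub>A\<^esub> d (g \<otimes>\<^bsub>H\<^esub> h, k))"
      using ghk by (simp add: Z2D[OF c] Z2D[OF d])
    finally show "a g ((c \<otimes>\<^bsub>Z2 H A a\<^esub> d) (h, k)) \<otimes>\<^bsub>A\<^esub> (c \<otimes>\<^bsub>Z2 H A a\<^esub> d) (g, h \<otimes>\<^bsub>H\<^esub> k)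
      = (c \<otimes>\<^bsub>Z2 H A a\<^esub> d) (g, h) \<otimes>\<^bsub>A\<^esub> (c \<otimes>\<^bsub>Z2 H A a\<^esub> d) (g \<otimes>\<^bsub>H\<^esub> h, k)"
      using ghk by (simp add: Z2_mult A.m_ac act Z2D(1)[OF c] Z2D(1)[OF d])
  qed (use Z2D[OF c] Z2D[OF d] in \<open>auto simp: Z2_mult\<close>)
next
  show "\<one>\<^bsub>Z2 H A a\<^esub> \<in> carrier (Z2 H A a)"
    by (rule Z2I) (auto simp: Z2_one act)
next
  fix c d e
  assume c: "c \<in> carrier (Z2 H A a)" and d: "d \<in> carrier (Z2 H A a)" and e: "e \<in> carrier (Z2 H A a)"
  show "c \<otimes>\<^bsub>Z2 H A a\<^esub> d \<otimes>\<^bsub>Z2 H A a\<^esub> e = c \<otimes>\<^bsub>Z2 H A a\<^esub> (d \<otimes>\<^bsub>Z2 H A a\<^esub> e)"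
    by (rule Z2_ext) (auto simp: Z2_mult Z2D[OF c] Z2D[OF d] Z2D[OF e] A.m_assoc)
next
  fix c d
  assume c: "c \<in> carrier (Z2 H A a)" and d: "d \<in> carrier (Z2 H A a)"
  show "c \<otimes>\<^bsub>Z2 H A a\<^esub> d = d \<otimes>\<^bsub>Z2 H A a\<^esub> c"
    by (rule Z2_ext) (auto simp: Z2_mult Z2D[OF c] Z2D[OF d] A.m_comm)
next
  fix c assume c: "c \<in> carrier (Z2 H A a)"
  show "\<one>\<^bsub>Z2 H A a\<^esub> \<otimes>\<^bsub>Z2 H A a\<^esub> c = c"
    by (rule Z2_ext) (auto simp: Z2_mult Z2_one Z2D[OF c] Z2_extensional[OF c])
next
  fix c assume c: "c \<in> carrier (Z2 H A a)"
  define d where "d = (\<lambda>x\<in>carrier H \<times> carrier H. inv\<^bsub>A\<^esub> c x)"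
  have "d \<in> carrier (Z2 H A a)"
  proof (rule Z2I)
    fix g h k assume ghk: "g \<in> carrier H" "h \<in> carrier H" "k \<in> carrier H"
    then show "a g (d (h, k)) \<otimes>\<^bsub>A\<^esub> d (g, h \<otimes>\<^bsub>H\<^esub> k) = d (g, h) \<otimes>\<^bsub>A\<^esub> d (g \<otimes>\<^bsub>H\<^esub> h, k)"
      by (simp add: d_def act Z2D[OF c] flip: A.inv_mult)
  qed (auto simp: d_def Z2D[OF c])
  moreover have "d \<otimes>\<^bsub>Z2 H A a\<^esub> c = \<one>\<^bsub>Z2 H A a\<^esub>"
    by (rule Z2_ext) (auto simp: Z2_mult Z2_one d_def Z2D[OF c])
  ultimately show "\<exists>d\<in>carrier (Z2 H A a). d \<otimes>\<^bsub>Z2 H A a\<^esub> c = \<one>\<^bsub>Z2 H A a\<^esub>"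
    by blast
qed

sublocale Z2: comm_group "Z2 H A a"
  by (rule comm_group_Z2)

lemma coboundary_mult:
  assumes "f \<in> carrier H \<rightarrow> carrier A" "f' \<in> carrier H \<rightarrow> carrier A"
  shows "coboundary H A a (\<lambda>g. f g \<otimes>\<^bsub>A\<^esub> f' g) = coboundary H A a f \<otimes>\<^bsub>Z2 H A a\<^esub> coboundary H A a f'"
proof -
  have "f g \<in> carrier A" "f' g \<in> carrier A" if "g \<in> carrier H" for g
    using assms that by auto
  then show ?thesis
    by (intro Z2_ext) (auto simp: coboundary_def Z2_mult act A.inv_mult A.m_ac)
qed

lemma coboundary_in_Z2:
  assumes "f \<in> carrier H \<rightarrow> carrier A"
  shows "coboundary H A a f \<in> carrier (Z2 H A a)"
proof -
  have f: "f g \<in> carrier A" if "g \<in> carrier H" for g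
    using assms that by auto
  have swap: "u \<otimes>\<^bsub>A\<^esub> v \<otimes>\<^bsub>A\<^esub> r' \<otimes>\<^bsub>A\<^esub> (w \<otimes>\<^bsub>A\<^esub> r \<otimes>\<^bsub>A\<^esub> z) = w \<otimes>\<^bsub>A\<^esub> u \<otimes>\<^bsub>A\<^esub> t' \<otimes>\<^bsub>A\<^esub> (t \<otimes>\<^bsub>A\<^esub> v \<otimes>\<^bsub>A\<^esub> z)"
    if inv: "r' \<otimes>\<^bsub>A\<^esub> r = \<one>\<^bsub>A\<^esub>" "t' \<otimes>\<^bsub>A\<^esub> t = \<one>\<^bsub>A\<^esub>"
      and cl: "u \<in> carrier A" "v \<in> carrier A" "w \<in> carrier A" "z \<in> carrier A"
        "r \<in> carrier A" "r' \<in> carrier A" "t \<in> carrier A" "t' \<in> carrier A"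
    for u v w z r r' t t'
  proof -
    have "u \<otimes>\<^bsub>A\<^esub> v \<otimes>\<^bsub>A\<^esub> r' \<otimes>\<^bsub>A\<^esub> (w \<otimes>\<^bsub>A\<^esub> r \<otimes>\<^bsub>A\<^esub> z) = (r' \<otimes>\<^bsub>A\<^esub> r) \<otimes>\<^bsub>A\<^esub> (u \<otimes>\<^bsub>A\<^esub> v \<otimes>\<^bsub>A\<^esub> w \<otimes>\<^bsub>A\<^esub> z)"
      using cl by (simp add: A.m_ac)
    moreover have "w \<otimes>\<^bsub>A\<^esub> u \<otimes>\<^bsub>A\<^esub> t' \<otimes>\<^bsub>A\<^esub> (t \<otimes>\<^bsub>A\<^esub> v \<otimes>\<^bsub>A\<^esub> z) = (t' \<otimes>\<^bsub>A\<^esub> t) \<otimes>\<^bsub>A\<^esub> (u \<otimes>\<^bsub>A\<^esub> v \<otimes>\<^bsub>A\<^esub> w \<otimes>\<^bsub>A\<^esub> z)"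
      using cl by (simp add: A.m_ac)
    ultimately show ?thesis
      by (simp add: inv)
  qed
  show ?thesis
  proof (rule Z2I)
    fix g h k assume "g \<in> carrier H" "h \<in> carrier H" "k \<in> carrier H"
    then show "a g (coboundary H A a f (h, k)) \<otimes>\<^bsub>A\<^esub> coboundary H A a f (g, h \<otimes>\<^bsub>H\<^esub> k) =
        coboundary H A a f (g, h) \<otimes>\<^bsub>A\<^esub> coboundary H A a f (g \<otimes>\<^bsub>H\<^esub> h, k)"
      by (simp add: coboundary_def act f H.m_assoc) (rule swap; simp add: act f)
  qed (auto simp: coboundary_def act f)
qed

lemma subgroup_B2: "subgroup (B2 H A a) (Z2 H A a)"
proof (rule Z2.subgroupI)
  show "B2 H A a \<subseteq> carrier (Z2 H A a)" "B2 H A a \<noteq> {}"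
    using coboundary_in_Z2 by (auto simp: B2_def)
  show "c \<otimes>\<^bsub>Z2 H A a\<^esub> d \<in> B2 H A a" if cd: "c \<in> B2 H A a" "d \<in> B2 H A a" for c d
  proof -
    obtain f f' where ff': "f \<in> carrier H \<rightarrow> carrier A" "f' \<in> carrier H \<rightarrow> carrier A"
      and "c = coboundary H A a f" "d = coboundary H A a f'"
      using cd by (auto simp: B2_def)
    then have "c \<otimes>\<^bsub>Z2 H A a\<^esub> d = coboundary H A a (\<lambda>g. f g \<otimes>\<^bsub>A\<^esub> f' g)"
      by (simp add: coboundary_mult)
    moreover have "(\<lambda>g. f g \<otimes>\<^bsub>A\<^esub> f' g) \<in> carrier H \<rightarrow> carrier A"
      using ff' by auto
    ultimately show ?thesis
      by (simp add: B2_def)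
  qed
  show "inv\<^bsub>Z2 H A a\<^esub> c \<in> B2 H A a" if cB: "c \<in> B2 H A a" for c
  proof -
    obtain f where f: "f \<in> carrier H \<rightarrow> carrier A" and c: "c = coboundary H A a f"
      using cB by (auto simp: B2_def)
    then have fc: "f g \<in> carrier A" if "g \<in> carrier H" for g
      using that by auto
    have f': "(\<lambda>g. inv\<^bsub>A\<^esub> f g) \<in> carrier H \<rightarrow> carrier A"
      using f by auto
    have "coboundary H A a (\<lambda>g. inv\<^bsub>A\<^esub> f g) \<otimes>\<^bsub>Z2 H A a\<^esub> c = coboundary H A a (\<lambda>g. inv\<^bsub>A\<^esub> f g \<otimes>\<^bsub>A\<^esub> f g)"
      using f f' by (simp add: c coboundary_mult)
    also have "\<dots> = \<one>\<^bsub>Z2 H A a\<^esub>"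
      by (rule Z2_ext) (auto simp: coboundary_def Z2_one fc act)
    finally have "inv\<^bsub>Z2 H A a\<^esub> c = coboundary H A a (\<lambda>g. inv\<^bsub>A\<^esub> f g)"
      using f f' c by (intro Z2.inv_equality) (auto intro: coboundary_in_Z2)
    then show ?thesis
      using f' by (simp add: B2_def)
  qed
qed

lemma comm_group_H2: "comm_group (H2 H A a)"
  unfolding H2_def by (rule Z2.abelian_FactGroup[OF subgroup_B2])

lemma H2_class_closed: "c \<in> carrier (Z2 H A a) \<Longrightarrow> H2_class H A a c \<in> carrier (H2 H A a)"
  by (auto simp: H2_class_def H2_def FactGroup_def RCOSETS_def)

lemma H2_class_eqI:
  assumes "c \<in> carrier (Z2 H A a)" and "f \<in> carrier H \<rightarrow> carrier A"
    and "\<And>g h. \<lbrakk>g \<in> carrier H; h \<in> carrier H\<rbrakk> \<Longrightarrow> d (g, h) = coboundary H A a f (g, h) \<otimes>\<^bsub>A\<^esub> c (g, h)"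
    and "d \<in> extensional (carrier H \<times> carrier H)"
  shows "H2_class H A a d = H2_class H A a c"
proof -
  have "d = coboundary H A a f \<otimes>\<^bsub>Z2 H A a\<^esub> c"
    using assms(3,4) by (intro Z2_ext) (auto simp: Z2_mult)
  moreover have "coboundary H A a f \<in> B2 H A a"
    using assms(2) by (simp add: B2_def)
  ultimately have "d \<in> B2 H A a #>\<^bsub>Z2 H A a\<^esub> c"
    by (auto simp: r_coset_def)
  then show ?thesis
    unfolding H2_class_def
    using Z2.repr_independence[OF _ assms(1) subgroup_B2] by simp
qed

end

locale two_extensions =
  G: group G + G0: group G0 + Gam: group Gam + Gam0: group Gam0
  for G :: "('g, 'x) monoid_scheme" and G0 :: "('h, 'y) monoid_scheme"
    and Gam :: "('m, 'z) monoid_scheme" and Gam0 :: "('n, 'w) monoid_scheme"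
    and G1 :: "'g set" and Gam1 :: "'m set"
    and p :: "'g \<Rightarrow> 'h" and q :: "'m \<Rightarrow> 'n"
    and a :: "'h \<Rightarrow> 'm \<Rightarrow> 'm" and a1 :: "'h \<Rightarrow> 'm \<Rightarrow> 'm" and a0 :: "'h \<Rightarrow> 'n \<Rightarrow> 'n" +
  assumes p: "p \<in> epi G G0" and ker_p: "kernel G G0 p = G1"
    and q: "q \<in> epi Gam Gam0" and ker_q: "kernel Gam Gam0 q = Gam1"
    and central: "\<forall>z\<in>Gam1. \<forall>x\<in>carrier Gam. z \<otimes>\<^bsub>Gam\<^esub> x = x \<otimes>\<^bsub>Gam\<^esub> z"
    and a1: "a1 \<in> hom G0 (AutoGroup (Gam\<lparr>carrier := Gam1\<rparr>))"
    and a: "a \<in> hom G0 (AutoGroup Gam)"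
    and a0: "a0 \<in> hom G0 (AutoGroup Gam0)"
    and a1_eq: "\<forall>g\<in>carrier G0. \<forall>z\<in>Gam1. a1 g z = a g z"
    and q_equivariant: "\<forall>g\<in>carrier G0. \<forall>x\<in>carrier Gam. q (a g x) = a0 g (q x)"
begin

sublocale p: group_hom G G0 p
  using p by unfold_locales (simp add: epi_def)

sublocale q: group_hom Gam Gam0 q
  using q by unfold_locales (simp add: epi_def)

lemma G1: "subgroup G1 G" and Gam1: "subgroup Gam1 Gam"
  using p.subgroup_kernel q.subgroup_kernel by (simp_all add: ker_p ker_q)

lemma in_G1: "n \<in> G1 \<longleftrightarrow> n \<in> carrier G \<and> p n = \<one>\<^bsub>G0\<^esub>"
  and in_Gam1: "z \<in> Gam1 \<longleftrightarrow> z \<in> carrier Gam \<and> q z = \<one>\<^bsub>Gam0\<^esub>"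
  by (auto simp: kernel_def simp flip: ker_p ker_q)

abbreviation (input) A where "A \<equiv> Gam\<lparr>carrier := Gam1\<rparr>"

lemma comm_group_A: "comm_group A"
proof -
  interpret S: group A
    using Gam1 by (rule Gam.subgroup_imp_group)
  show ?thesis
    by (rule S.group_comm_groupI) (use central in \<open>simp add: in_Gam1\<close>)
qed

sublocale coefficient_module G0 A a1
  using comm_group_A a1 by (simp add: coefficient_module_def coefficient_module_axioms_def G0.is_group)

lemma inv_A: "z \<in> Gam1 \<Longrightarrow> inv\<^bsub>A\<^esub> z = inv\<^bsub>Gam\<^esub> z"
  using Gam.m_inv_consistent[OF Gam1] by simp

lemmas Gam_act = hom_AutoGroupD(2-6)[OF a G0.is_group Gam.is_group]
lemmas Gam0_act = hom_AutoGroupD(2-6)[OF a0 G0.is_group Gam0.is_group]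

lemma cancel:
  assumes "x \<in> carrier Gam" "y \<in> carrier Gam"
  shows "inv\<^bsub>Gam\<^esub> x \<otimes>\<^bsub>Gam\<^esub> (x \<otimes>\<^bsub>Gam\<^esub> y) = y" "x \<otimes>\<^bsub>Gam\<^esub> (inv\<^bsub>Gam\<^esub> x \<otimes>\<^bsub>Gam\<^esub> y) = y"
  using assms by (simp_all flip: Gam.m_assoc)

lemma ex_section_p: "\<exists>s. set_section G G0 p s"
  unfolding set_section_def using p
  by (intro exI[of _ "inv_into (carrier G) p"]) (auto simp: epi_def inv_into_into f_inv_into_f)

lemma ex_section_q: "\<exists>t. set_section Gam Gam0 q t"
  unfolding set_section_def using q
  by (intro exI[of _ "inv_into (carrier Gam) q"]) (auto simp: epi_def inv_into_into f_inv_into_f)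

lemma Z1_rel_refl:
  assumes "c \<in> Z1 G0 Gam0 a0"
  shows "(c, c) \<in> Z1_rel G0 Gam0 a0"
proof -
  have "c g \<in> carrier Gam0" if "g \<in> carrier G0" for g
    using assms that by (auto simp: Z1_def)
  then show ?thesis
    using assms by (auto simp: Z1_rel_def Gam0_act intro!: bexI[of _ "\<one>\<^bsub>Gam0\<^esub>"])
qed

lemma coboundary_lift:
  assumes c: "c \<in> Z1 G0 Gam0 a0" and f: "\<And>g. g \<in> carrier G0 \<Longrightarrow> f g \<in> carrier Gam \<and> q (f g) = c g"
  shows "coboundary G0 Gam a f \<in> carrier (Z2 G0 A a1)"
proof -
  define D where "D = coboundary G0 Gam a f"
  have D: "D (g, h) = f g \<otimes>\<^bsub>Gam\<^esub> a g (f h) \<otimes>\<^bsub>Gam\<^esub> inv\<^bsub>Gam\<^esub> f (g \<otimes>\<^bsub>G0\<^esub> h)"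
    if "g \<in> carrier G0" "h \<in> carrier G0" for g h
    using that by (simp add: D_def coboundary_def)
  have c': "c (g \<otimes>\<^bsub>G0\<^esub> h) = c g \<otimes>\<^bsub>Gam0\<^esub> a0 g (c h)" "c g \<in> carrier Gam0"
    if "g \<in> carrier G0" "h \<in> carrier G0" for g h
    using that c by (auto simp: Z1_def)
  have DC: "D (g, h) \<in> Gam1" if gh: "g \<in> carrier G0" "h \<in> carrier G0" for g h
    using gh by (simp add: D in_Gam1 f Gam_act Gam0_act c' q_equivariant Gam0.m_assoc)
  then have DG: "D (g, h) \<in> carrier Gam" if gh: "g \<in> carrier G0" "h \<in> carrier G0" for g h
    using gh by (simp add: in_Gam1)
  have Df: "D (g, h) \<otimes>\<^bsub>Gam\<^esub> f (g \<otimes>\<^bsub>G0\<^esub> h) = f g \<otimes>\<^bsub>Gam\<^esub> a g (f h)"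
    if gh: "g \<in> carrier G0" "h \<in> carrier G0" for g h
    using gh by (simp add: D f Gam_act Gam.m_assoc)
  show ?thesis
    unfolding D_def[symmetric]
  proof (rule Z2I)
    fix g h k assume ghk: "g \<in> carrier G0" "h \<in> carrier G0" "k \<in> carrier G0"
    note cl = ghk f Gam_act DG Gam.m_assoc
    let ?w = "f (g \<otimes>\<^bsub>G0\<^esub> (h \<otimes>\<^bsub>G0\<^esub> k))"
    have z: "a g (D (h, k)) \<in> Gam1"
      using act(1)[of g "D (h, k)"] ghk DC a1_eq by simp
    have "(a g (D (h, k)) \<otimes>\<^bsub>Gam\<^esub> D (g, h \<otimes>\<^bsub>G0\<^esub> k)) \<otimes>\<^bsub>Gam\<^esub> ?w
        = a g (D (h, k)) \<otimes>\<^bsub>Gam\<^esub> (f g \<otimes>\<^bsub>Gam\<^esub> a g (f (h \<otimes>\<^bsub>G0\<^esub> k)))"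
      using ghk by (simp add: cl Df)
    also have "\<dots> = f g \<otimes>\<^bsub>Gam\<^esub> (a g (D (h, k)) \<otimes>\<^bsub>Gam\<^esub> a g (f (h \<otimes>\<^bsub>G0\<^esub> k)))"
      using z central ghk by (simp add: cl flip: Gam.m_assoc)
    also have "\<dots> = f g \<otimes>\<^bsub>Gam\<^esub> a g (D (h, k) \<otimes>\<^bsub>Gam\<^esub> f (h \<otimes>\<^bsub>G0\<^esub> k))"
      using ghk by (simp add: cl)
    also have "\<dots> = (f g \<otimes>\<^bsub>Gam\<^esub> a g (f h)) \<otimes>\<^bsub>Gam\<^esub> a (g \<otimes>\<^bsub>G0\<^esub> h) (f k)"
      using ghk by (simp add: cl Df)
    also have "\<dots> = D (g, h) \<otimes>\<^bsub>Gam\<^esub> (f (g \<otimes>\<^bsub>G0\<^esub> h) \<otimes>\<^bsub>Gam\<^esub> a (g \<otimes>\<^bsub>G0\<^esub> h) (f k))"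
      using ghk by (simp add: cl flip: Df)
    also have "\<dots> = (D (g, h) \<otimes>\<^bsub>Gam\<^esub> D (g \<otimes>\<^bsub>G0\<^esub> h, k)) \<otimes>\<^bsub>Gam\<^esub> ?w"
      using ghk Df[of "g \<otimes>\<^bsub>G0\<^esub> h" k] by (simp add: f Gam_act DG Gam.m_assoc G0.m_assoc)
    finally show "a1 g (D (h, k)) \<otimes>\<^bsub>A\<^esub> D (g, h \<otimes>\<^bsub>G0\<^esub> k) = D (g, h) \<otimes>\<^bsub>A\<^esub> D (g \<otimes>\<^bsub>G0\<^esub> h, k)"
      using ghk DC a1_eq by (simp add: f DG Gam_act)
  qed (use DC in \<open>auto simp: D_def coboundary_def\<close>)
qed

lemma coboundary_lift_class:
  assumes c: "(c, c') \<in> Z1_rel G0 Gam0 a0"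
    and f: "\<And>g. g \<in> carrier G0 \<Longrightarrow> f g \<in> carrier Gam \<and> q (f g) = c g"
    and f': "\<And>g. g \<in> carrier G0 \<Longrightarrow> f' g \<in> carrier Gam \<and> q (f' g) = c' g"
  shows "H2_class G0 A a1 (coboundary G0 Gam a f') = H2_class G0 A a1 (coboundary G0 Gam a f)"
proof -
  obtain m where m: "m \<in> carrier Gam0"
    and cm: "\<And>g. g \<in> carrier G0 \<Longrightarrow> c' g = inv\<^bsub>Gam0\<^esub> m \<otimes>\<^bsub>Gam0\<^esub> c g \<otimes>\<^bsub>Gam0\<^esub> a0 g m"
    and Z: "c \<in> Z1 G0 Gam0 a0"
    using c by (auto simp: Z1_rel_def)
  have "m \<in> q ` carrier Gam"
    using q m by (simp add: epi_def)
  then obtain M where "m = q M" "M \<in> carrier Gam"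
    by (rule imageE)
  then have M: "M \<in> carrier Gam" "q M = m"
    by simp_all
  define u where "u g = inv\<^bsub>Gam\<^esub> M \<otimes>\<^bsub>Gam\<^esub> f g \<otimes>\<^bsub>Gam\<^esub> a g M" for g
  define z where "z g = f' g \<otimes>\<^bsub>Gam\<^esub> inv\<^bsub>Gam\<^esub> u g" for g
  have u: "u g \<in> carrier Gam" "q (u g) = c' g" if "g \<in> carrier G0" for g
    using that f M by (simp_all add: u_def Gam_act q_equivariant cm)
  have z: "z g \<in> Gam1" if "g \<in> carrier G0" for g
    using that f'[OF that] u[OF that] by (simp add: z_def in_Gam1) (metis Gam0.r_inv q.hom_closed)
  have zG: "z g \<in> carrier Gam" if "g \<in> carrier G0" for g
    using z[OF that] by (simp add: in_Gam1)
  have az: "a g (z h) \<in> Gam1" if "g \<in> carrier G0" "h \<in> carrier G0" for g h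
    using act(1)[of g "z h"] that z a1_eq by simp
  have f'u: "f' g = z g \<otimes>\<^bsub>Gam\<^esub> u g" if "g \<in> carrier G0" for g
    using that f' u by (simp add: z_def Gam.m_assoc)
  have comm: "z' \<otimes>\<^bsub>Gam\<^esub> x = x \<otimes>\<^bsub>Gam\<^esub> z'" if "z' \<in> Gam1" "x \<in> carrier Gam" for z' x
    using central that by blast
  let ?D = "coboundary G0 Gam a f"
  have D: "?D \<in> carrier (Z2 G0 A a1)"
    using coboundary_lift[OF Z f] .
  show ?thesis
  proof (rule H2_class_eqI[OF D, of z])
    show "z \<in> carrier G0 \<rightarrow> carrier A"
      using z by simp
    show "coboundary G0 Gam a f' \<in> extensional (carrier G0 \<times> carrier G0)"
      by (simp add: coboundary_def)
    fix g h assume gh: "g \<in> carrier G0" "h \<in> carrier G0"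
    let ?k = "g \<otimes>\<^bsub>G0\<^esub> h"
    have k: "?k \<in> carrier G0" using gh by simp
    have DC: "?D (g, h) \<in> Gam1"
      using Z2D(1)[OF D gh] by simp
    then have DG: "?D (g, h) \<in> carrier Gam" by (simp add: in_Gam1)
    have Du: "u g \<otimes>\<^bsub>Gam\<^esub> a g (u h) \<otimes>\<^bsub>Gam\<^esub> inv\<^bsub>Gam\<^esub> u ?k = ?D (g, h)"
    proof -
      have "u g \<otimes>\<^bsub>Gam\<^esub> a g (u h) \<otimes>\<^bsub>Gam\<^esub> inv\<^bsub>Gam\<^esub> u ?k = inv\<^bsub>Gam\<^esub> M \<otimes>\<^bsub>Gam\<^esub> (?D (g, h) \<otimes>\<^bsub>Gam\<^esub> M)"
        using gh k M f by (simp add: u_def coboundary_def Gam_act Gam.inv_mult_group Gam.m_assoc cancel)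
      also have "\<dots> = ?D (g, h)"
        using M DG comm[OF DC, of M] by (simp add: cancel)
      finally show ?thesis .
    qed
    note cl = gh k u zG Gam_act
    have "coboundary G0 Gam a f' (g, h) =
        z g \<otimes>\<^bsub>Gam\<^esub> (u g \<otimes>\<^bsub>Gam\<^esub> a g (z h)) \<otimes>\<^bsub>Gam\<^esub> (a g (u h) \<otimes>\<^bsub>Gam\<^esub> inv\<^bsub>Gam\<^esub> u ?k \<otimes>\<^bsub>Gam\<^esub> inv\<^bsub>Gam\<^esub> z ?k)"
      using gh k by (simp add: coboundary_def f'u cl Gam.inv_mult_group Gam.m_assoc)
    also have "\<dots> = z g \<otimes>\<^bsub>Gam\<^esub> a g (z h) \<otimes>\<^bsub>Gam\<^esub> (?D (g, h) \<otimes>\<^bsub>Gam\<^esub> inv\<^bsub>Gam\<^esub> z ?k)"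
      using gh k by (simp add: cl Gam.m_assoc flip: Du comm[OF az[OF gh] u(1)[OF gh(1)]])
    also have "\<dots> = z g \<otimes>\<^bsub>Gam\<^esub> a g (z h) \<otimes>\<^bsub>Gam\<^esub> inv\<^bsub>Gam\<^esub> z ?k \<otimes>\<^bsub>Gam\<^esub> ?D (g, h)"
      using gh k DG by (simp add: cl Gam.m_assoc comm[OF DC])
    finally show "coboundary G0 Gam a f' (g, h) = coboundary G0 A a1 z (g, h) \<otimes>\<^bsub>A\<^esub> ?D (g, h)"
      using gh k z a1_eq by (simp add: coboundary_def inv_A)
  qed
qed

lemma Delta_cocycle_coboundary: "Delta_cocycle G0 Gam a t c = coboundary G0 Gam a (t \<circ> c)"
  by (simp add: Delta_cocycle_def coboundary_def)

lemma Delta_cocycle_in_Z2: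
  assumes "set_section Gam Gam0 q t" "c \<in> Z1 G0 Gam0 a0"
  shows "Delta_cocycle G0 Gam a t c \<in> carrier (Z2 G0 A a1)"
  unfolding Delta_cocycle_coboundary
  using assms by (intro coboundary_lift) (auto simp: set_section_def Z1_def PiE_iff)

theorem Delta_eq:
  assumes t: "set_section Gam Gam0 q t" and c: "c \<in> Z1 G0 Gam0 a0"
  shows "Delta G0 Gam Gam0 q Gam1 a a1 (H1_class G0 Gam0 a0 c)
    = H2_class G0 A a1 (Delta_cocycle G0 Gam a t c)"
proof -
  define t' where "t' = (SOME t. set_section Gam Gam0 q t)"
  define c' where "c' = (SOME c'. c' \<in> H1_class G0 Gam0 a0 c)"
  have "c \<in> H1_class G0 Gam0 a0 c"
    using Z1_rel_refl[OF c] by (simp add: H1_class_def)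
  then have "c' \<in> H1_class G0 Gam0 a0 c"
    unfolding c'_def by (rule someI[of "\<lambda>c'. c' \<in> H1_class G0 Gam0 a0 c"])
  then have r: "(c, c') \<in> Z1_rel G0 Gam0 a0"
    by (simp add: H1_class_def)
  then have c': "c' \<in> Z1 G0 Gam0 a0"
    by (simp add: Z1_rel_def)
  have t': "set_section Gam Gam0 q t'"
    unfolding t'_def using someI_ex[OF ex_section_q] .
  show ?thesis
    unfolding Delta_def Delta_cocycle_coboundary t'_def[symmetric] c'_def[symmetric]
    using t t' c c' by (intro coboundary_lift_class[OF r]) (auto simp: set_section_def Z1_def PiE_iff)
qed

context
  fixes f assumes f: "f \<in> Hom_inv G G1 A (a1 \<circ> p)"
begin

lemma f_closed: "n \<in> G1 \<Longrightarrow> f n \<in> Gam1"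
  and f_mult: "\<lbrakk>n \<in> G1; n' \<in> G1\<rbrakk> \<Longrightarrow> f (n \<otimes>\<^bsub>G\<^esub> n') = f n \<otimes>\<^bsub>Gam\<^esub> f n'"
  using f by (auto simp: Hom_inv_def hom_def)

lemma f_inv: "n \<in> G1 \<Longrightarrow> f (inv\<^bsub>G\<^esub> n) = inv\<^bsub>A\<^esub> f n"
proof -
  assume n: "n \<in> G1"
  interpret f: group_hom "G\<lparr>carrier := G1\<rparr>" A f
    using f G.subgroup_imp_group[OF G1] A.is_group
    by (simp add: group_hom_def group_hom_axioms_def Hom_inv_def)
  show ?thesis
    using f.hom_inv[of n] n G.m_inv_consistent[OF G1 n] by simp
qed

lemma f_conj:
  assumes "g \<in> carrier G" "n \<in> G1"
  shows "g \<otimes>\<^bsub>G\<^esub> n \<otimes>\<^bsub>G\<^esub> inv\<^bsub>G\<^esub> g \<in> G1"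
    and "f (g \<otimes>\<^bsub>G\<^esub> n \<otimes>\<^bsub>G\<^esub> inv\<^bsub>G\<^esub> g) = a1 (p g) (f n)"
proof -
  have n: "n \<in> carrier G" "p n = \<one>\<^bsub>G0\<^esub>"
    using assms by (simp_all add: in_G1)
  then show *: "g \<otimes>\<^bsub>G\<^esub> n \<otimes>\<^bsub>G\<^esub> inv\<^bsub>G\<^esub> g \<in> G1"
    using assms(1) by (simp add: in_G1)
  have "inv\<^bsub>G\<^esub> g \<otimes>\<^bsub>G\<^esub> (g \<otimes>\<^bsub>G\<^esub> n \<otimes>\<^bsub>G\<^esub> inv\<^bsub>G\<^esub> g) \<otimes>\<^bsub>G\<^esub> g = n"
    using assms(1) n by (simp add: G.m_assoc flip: G.m_assoc[of "inv\<^bsub>G\<^esub> g" g])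
  then show "f (g \<otimes>\<^bsub>G\<^esub> n \<otimes>\<^bsub>G\<^esub> inv\<^bsub>G\<^esub> g) = a1 (p g) (f n)"
    using f * assms(1) unfolding Hom_inv_def by fastforce
qed

lemma section_beta:
  assumes s: "set_section G G0 p s" and xy: "x \<in> carrier G0" "y \<in> carrier G0"
  shows "s x \<otimes>\<^bsub>G\<^esub> s y \<otimes>\<^bsub>G\<^esub> inv\<^bsub>G\<^esub> s (x \<otimes>\<^bsub>G0\<^esub> y) \<in> G1"
proof -
  have "s g \<in> carrier G" "p (s g) = g" if "g \<in> carrier G0" for g
    using s that by (auto simp: set_section_def)
  then show ?thesis
    using xy by (simp add: in_G1)
qed

lemma Tra_cocycle_in_Z2:
  assumes s: "set_section G G0 p s"
  shows "Tra_cocycle G G0 A s f \<in> carrier (Z2 G0 A a1)"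
proof -
  define b where "b x y = s x \<otimes>\<^bsub>G\<^esub> s y \<otimes>\<^bsub>G\<^esub> inv\<^bsub>G\<^esub> s (x \<otimes>\<^bsub>G0\<^esub> y)" for x y
  have sc: "s g \<in> carrier G" "p (s g) = g" if "g \<in> carrier G0" for g
    using s that by (auto simp: set_section_def)
  have b: "b x y \<in> G1" if "x \<in> carrier G0" "y \<in> carrier G0" for x y
    using section_beta[OF s that] by (simp add: b_def)
  have T: "Tra_cocycle G G0 A s f (x, y) = inv\<^bsub>A\<^esub> f (b x y)" if "x \<in> carrier G0" "y \<in> carrier G0" for x y
    using that by (simp add: Tra_cocycle_def b_def)
  have cancel: "inv\<^bsub>G\<^esub> x \<otimes>\<^bsub>G\<^esub> (x \<otimes>\<^bsub>G\<^esub> y) = y" "x \<otimes>\<^bsub>G\<^esub> (inv\<^bsub>G\<^esub> x \<otimes>\<^bsub>G\<^esub> y) = y"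
    if "x \<in> carrier G" "y \<in> carrier G" for x y
    using that by (simp_all flip: G.m_assoc)
  show ?thesis
  proof (rule Z2I)
    fix g h k assume ghk: "g \<in> carrier G0" "h \<in> carrier G0" "k \<in> carrier G0"
    have "(s g \<otimes>\<^bsub>G\<^esub> b h k \<otimes>\<^bsub>G\<^esub> inv\<^bsub>G\<^esub> s g) \<otimes>\<^bsub>G\<^esub> b g (h \<otimes>\<^bsub>G0\<^esub> k) = b g h \<otimes>\<^bsub>G\<^esub> b (g \<otimes>\<^bsub>G0\<^esub> h) k"
      using ghk by (simp add: b_def sc G.m_assoc G0.m_assoc cancel)
    then have "f (s g \<otimes>\<^bsub>G\<^esub> b h k \<otimes>\<^bsub>G\<^esub> inv\<^bsub>G\<^esub> s g) \<otimes>\<^bsub>Gam\<^esub> f (b g (h \<otimes>\<^bsub>G0\<^esub> k))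
        = f (b g h) \<otimes>\<^bsub>Gam\<^esub> f (b (g \<otimes>\<^bsub>G0\<^esub> h) k)"
      using ghk f_mult[OF f_conj(1)[OF sc(1)[OF ghk(1)] b[OF ghk(2,3)]], of "b g (h \<otimes>\<^bsub>G0\<^esub> k)"]
        f_mult[of "b g h" "b (g \<otimes>\<^bsub>G0\<^esub> h) k"]
      by (simp add: b)
    then have "a1 g (f (b h k)) \<otimes>\<^bsub>A\<^esub> f (b g (h \<otimes>\<^bsub>G0\<^esub> k)) = f (b g h) \<otimes>\<^bsub>A\<^esub> f (b (g \<otimes>\<^bsub>G0\<^esub> h) k)"
      using ghk by (simp add: b sc f_conj)
    moreover have "f (b x y) \<in> carrier A" if "x \<in> carrier G0" "y \<in> carrier G0" for x y
      using that by (simp add: b f_closed)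
    ultimately have "a1 g (inv\<^bsub>A\<^esub> f (b h k)) \<otimes>\<^bsub>A\<^esub> inv\<^bsub>A\<^esub> f (b g (h \<otimes>\<^bsub>G0\<^esub> k))
        = inv\<^bsub>A\<^esub> f (b g h) \<otimes>\<^bsub>A\<^esub> inv\<^bsub>A\<^esub> f (b (g \<otimes>\<^bsub>G0\<^esub> h) k)"
      using ghk by (simp only: act(1,3) G0.m_closed flip: A.inv_mult)
    then show "a1 g (Tra_cocycle G G0 A s f (h, k)) \<otimes>\<^bsub>A\<^esub> Tra_cocycle G G0 A s f (g, h \<otimes>\<^bsub>G0\<^esub> k) =
        Tra_cocycle G G0 A s f (g, h) \<otimes>\<^bsub>A\<^esub> Tra_cocycle G G0 A s f (g \<otimes>\<^bsub>G0\<^esub> h, k)"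
      using ghk by (simp add: T)
  next
    fix g h assume "g \<in> carrier G0" "h \<in> carrier G0"
    then show "Tra_cocycle G G0 A s f (g, h) \<in> carrier A"
      using A.inv_closed[of "f (b g h)"] by (simp add: T b f_closed)
  qed (simp add: Tra_cocycle_def)
qed

lemma Tra_cocycle_class:
  assumes s: "set_section G G0 p s" and s': "set_section G G0 p s'"
  shows "H2_class G0 A a1 (Tra_cocycle G G0 A s' f) = H2_class G0 A a1 (Tra_cocycle G G0 A s f)"
proof -
  have sc: "s g \<in> carrier G" "p (s g) = g" "s' g \<in> carrier G" "p (s' g) = g" if "g \<in> carrier G0" for g
    using s s' that by (auto simp: set_section_def)
  define b where "b x y = s x \<otimes>\<^bsub>G\<^esub> s y \<otimes>\<^bsub>G\<^esub> inv\<^bsub>G\<^esub> s (x \<otimes>\<^bsub>G0\<^esub> y)" for x y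
  define b' where "b' x y = s' x \<otimes>\<^bsub>G\<^esub> s' y \<otimes>\<^bsub>G\<^esub> inv\<^bsub>G\<^esub> s' (x \<otimes>\<^bsub>G0\<^esub> y)" for x y
  define n where "n x = s' x \<otimes>\<^bsub>G\<^esub> inv\<^bsub>G\<^esub> s x" for x
  have b: "b x y \<in> G1" "b' x y \<in> G1" if "x \<in> carrier G0" "y \<in> carrier G0" for x y
    using section_beta[OF s that] section_beta[OF s' that] by (simp_all add: b_def b'_def)
  have n: "n x \<in> G1" if "x \<in> carrier G0" for x
    using that by (simp add: n_def in_G1 sc)
  have T: "Tra_cocycle G G0 A s f (x, y) = inv\<^bsub>A\<^esub> f (b x y)"
    "Tra_cocycle G G0 A s' f (x, y) = inv\<^bsub>A\<^esub> f (b' x y)" if "x \<in> carrier G0" "y \<in> carrier G0" for x y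
    using that by (simp_all add: Tra_cocycle_def b_def b'_def)
  have cancel: "inv\<^bsub>G\<^esub> x \<otimes>\<^bsub>G\<^esub> (x \<otimes>\<^bsub>G\<^esub> y) = y" "x \<otimes>\<^bsub>G\<^esub> (inv\<^bsub>G\<^esub> x \<otimes>\<^bsub>G\<^esub> y) = y"
    if "x \<in> carrier G" "y \<in> carrier G" for x y
    using that by (simp_all flip: G.m_assoc)
  have fA: "f m \<in> carrier A" if "m \<in> G1" for m
    using that by (simp add: f_closed)
  have fm: "f (m \<otimes>\<^bsub>G\<^esub> m') = f m \<otimes>\<^bsub>A\<^esub> f m'" if "m \<in> G1" "m' \<in> G1" for m m'
    using that by (simp add: f_mult)
  note G1_closed = subgroup.m_closed[OF G1] subgroup.m_inv_closed[OF G1]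
  show ?thesis
  proof (rule H2_class_eqI[OF Tra_cocycle_in_Z2[OF s], of "\<lambda>x. inv\<^bsub>A\<^esub> f (n x)"])
    show "(\<lambda>x. inv\<^bsub>A\<^esub> f (n x)) \<in> carrier G0 \<rightarrow> carrier A"
      using n fA A.inv_closed by blast
    show "Tra_cocycle G G0 A s' f \<in> extensional (carrier G0 \<times> carrier G0)"
      by (simp add: Tra_cocycle_def)
    fix g h assume gh: "g \<in> carrier G0" "h \<in> carrier G0"
    let ?k = "g \<otimes>\<^bsub>G0\<^esub> h"
    have k: "?k \<in> carrier G0" using gh by simp
    have "b' g h = n g \<otimes>\<^bsub>G\<^esub> (s g \<otimes>\<^bsub>G\<^esub> n h \<otimes>\<^bsub>G\<^esub> inv\<^bsub>G\<^esub> s g) \<otimes>\<^bsub>G\<^esub> b g h \<otimes>\<^bsub>G\<^esub> inv\<^bsub>G\<^esub> n ?k"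
      using gh k by (simp add: b_def b'_def n_def sc G.m_assoc cancel G.inv_mult_group)
    then have "f (b' g h) = f (n g) \<otimes>\<^bsub>A\<^esub> a1 g (f (n h)) \<otimes>\<^bsub>A\<^esub> f (b g h) \<otimes>\<^bsub>A\<^esub> inv\<^bsub>A\<^esub> f (n ?k)"
      using gh k by (simp only: fm f_inv f_conj n b sc G1_closed)
    moreover have "f (n g) \<in> carrier A" "f (n ?k) \<in> carrier A" "f (b g h) \<in> carrier A" "f (n h) \<in> carrier A"
      using fA n b gh k by blast+
    ultimately have "inv\<^bsub>A\<^esub> f (b' g h) = inv\<^bsub>A\<^esub> f (n g) \<otimes>\<^bsub>A\<^esub> a1 g (inv\<^bsub>A\<^esub> f (n h)) \<otimes>\<^bsub>A\<^esub> inv\<^bsub>A\<^esub> (inv\<^bsub>A\<^esub> f (n ?k)) \<otimes>\<^bsub>A\<^esub> inv\<^bsub>A\<^esub> f (b g h)"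
      using act(1,3)[OF gh(1)] by (simp only: A.inv_mult A.m_closed A.inv_closed A.m_ac)
    then show "Tra_cocycle G G0 A s' f (g, h) =
        coboundary G0 A a1 (\<lambda>x. inv\<^bsub>A\<^esub> f (n x)) (g, h) \<otimes>\<^bsub>A\<^esub> Tra_cocycle G G0 A s f (g, h)"
      using gh k by (simp add: T coboundary_def)
  qed
qed

theorem Tra_eq:
  assumes "set_section G G0 p s"
  shows "Tra G G0 p A a1 f = H2_class G0 A a1 (Tra_cocycle G G0 A s f)"
  unfolding Tra_def
  by (rule Tra_cocycle_class[OF assms someI_ex[OF ex_section_p]])

end

end

end

theory Submission
  imports Defs
begin

text \<open>
  Fix a section \<open>s\<close> of \<open>p\<close> and let \<open>\<beta> x y = s x \<cdot> s y \<cdot> (s (x y))\<inverse>\<close>. A lift \<open>\<pi>\<close> is determined by \<open>\<pi>1\<close> and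
  by \<open>f = \<pi> \<circ> s\<close>, since every element of \<open>G\<close> is \<open>n \<cdot> s x\<close> with \<open>n\<close> in \<open>G1\<close>. Conversely
  \<open>n \<cdot> s x \<mapsto> \<pi>1 n \<cdot> f x\<close> is a lift exactly when \<open>f\<close> lifts \<open>\<pi>0\<close> through \<open>q\<close> and the coboundary of \<open>f\<close> is
  \<open>\<pi>1 \<circ> \<beta>\<close>. The coboundary of any lift of \<open>\<pi>0\<close> represents \<open>\<Delta>([\<pi>0])\<close>, and multiplying the lift by a
  central cochain multiplies this cocycle by an arbitrary coboundary; \<open>\<pi>1 \<circ> \<beta>\<close> represents \<open>Tra(\<pi>1)\<inverse>\<close>.
\<close>

section \<open>Inverses and equality of classes in second cohomology\<close>

context coefficient_module
begin

text \<open>The inverse in \<open>Z2 H A a\<close> is given only abstractly; evaluating the inverse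
  law at a pair determines its values in \<open>A\<close>.\<close>

lemma Z2_inv_apply:
  assumes c: "c \<in> carrier (Z2 H A a)" and gh: "g \<in> carrier H" "h \<in> carrier H"
  shows "(inv\<^bsub>Z2 H A a\<^esub> c) (g, h) = inv\<^bsub>A\<^esub> c (g, h)"
proof -
  have "(inv\<^bsub>Z2 H A a\<^esub> c \<otimes>\<^bsub>Z2 H A a\<^esub> c) (g, h) = \<one>\<^bsub>Z2 H A a\<^esub> (g, h)"
    using c by simp
  then have "(inv\<^bsub>Z2 H A a\<^esub> c) (g, h) \<otimes>\<^bsub>A\<^esub> c (g, h) = \<one>\<^bsub>A\<^esub>"
    using gh unfolding Z2_mult Z2_one by simp
  then show ?thesis
    using Z2D(1)[OF c gh] Z2D(1)[OF Z2.inv_closed[OF c] gh] by (simp add: A.inv_equality)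
qed

text \<open>\<open>H2_class\<close> sends a cocycle to its coset modulo \<open>B2 H A a\<close>, so
  it is the quotient homomorphism and preserves inverses.\<close>

lemma inv_H2_class:
  assumes "c \<in> carrier (Z2 H A a)"
  shows "inv\<^bsub>H2 H A a\<^esub> (H2_class H A a c) = H2_class H A a (inv\<^bsub>Z2 H A a\<^esub> c)"
proof -
  interpret B: normal "B2 H A a" "Z2 H A a"
    using subgroup_B2 by (rule Z2.normal_iff_subgroup[THEN iffD2])
  interpret P: group_hom "Z2 H A a" "H2 H A a" "H2_class H A a"
    using B.r_coset_hom_Mod B.factorgroup_is_group Z2.is_group
    by (simp add: group_hom_def group_hom_axioms_def H2_def H2_class_def[abs_def])
  show ?thesis
    using P.hom_inv[OF assms] by simp
qed

text \<open>Converse of \<open>H2_class_eqI\<close>: it extracts the cochain by which a lift has to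
  be corrected.\<close>

lemma H2_class_eqD:
  assumes d: "d \<in> carrier (Z2 H A a)" and eq: "H2_class H A a d = H2_class H A a c"
  obtains f where "f \<in> carrier H \<rightarrow> carrier A"
    and "\<And>g h. \<lbrakk>g \<in> carrier H; h \<in> carrier H\<rbrakk> \<Longrightarrow> d (g, h) = coboundary H A a f (g, h) \<otimes>\<^bsub>A\<^esub> c (g, h)"
proof -
  have "d \<in> B2 H A a #>\<^bsub>Z2 H A a\<^esub> c"
    using Z2.rcos_self[OF d subgroup_B2] eq by (simp add: H2_class_def)
  then obtain f where "f \<in> carrier H \<rightarrow> carrier A" "d = coboundary H A a f \<otimes>\<^bsub>Z2 H A a\<^esub> c"
    by (auto simp: r_coset_def B2_def)
  then show thesis
    by (intro that) (simp_all add: Z2_mult)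
qed

end

section \<open>Central cochains and cocycle lifts\<close>

context two_extensions
begin

lemma Gam1_commute: "\<lbrakk>z \<in> Gam1; x \<in> carrier Gam\<rbrakk> \<Longrightarrow> x \<otimes>\<^bsub>Gam\<^esub> z = z \<otimes>\<^bsub>Gam\<^esub> x"
  using central by simp

lemma Gam_act_Gam1: "\<lbrakk>g \<in> carrier G0; z \<in> Gam1\<rbrakk> \<Longrightarrow> a g z \<in> Gam1"
  using act(1)[of g z] a1_eq by simp

text \<open>Only the factors coming from \<open>z\<close> are moved: they are central, also after
  the action, so the non-commuting factors from \<open>f\<close> keep their order.\<close>

lemma coboundary_mult_Gam1:
  assumes z: "z \<in> carrier G0 \<rightarrow> Gam1" and f: "f \<in> carrier G0 \<rightarrow> carrier Gam"
    and gh: "g \<in> carrier G0" "h \<in> carrier G0"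
  shows "coboundary G0 Gam a (\<lambda>x. z x \<otimes>\<^bsub>Gam\<^esub> f x) (g, h)
    = coboundary G0 A a1 z (g, h) \<otimes>\<^bsub>Gam\<^esub> coboundary G0 Gam a f (g, h)"
proof -
  let ?k = "g \<otimes>\<^bsub>G0\<^esub> h"
  have k: "?k \<in> carrier G0" using gh by simp
  have z1: "z x \<in> Gam1" and zG: "z x \<in> carrier Gam" and fG: "f x \<in> carrier Gam" if "x \<in> carrier G0" for x
    using z f that by (auto simp: in_Gam1)
  have az: "a g (z h) \<in> Gam1"
    using gh z1 Gam_act_Gam1 by simp
  have iz: "inv\<^bsub>Gam\<^esub> z ?k \<in> Gam1"
    using subgroup.m_inv_closed[OF Gam1 z1[OF k]] .
  note cl = gh k zG fG Gam_act
  have "coboundary G0 Gam a (\<lambda>x. z x \<otimes>\<^bsub>Gam\<^esub> f x) (g, h)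
      = z g \<otimes>\<^bsub>Gam\<^esub> (f g \<otimes>\<^bsub>Gam\<^esub> a g (z h)) \<otimes>\<^bsub>Gam\<^esub> ((a g (f h) \<otimes>\<^bsub>Gam\<^esub> inv\<^bsub>Gam\<^esub> f ?k) \<otimes>\<^bsub>Gam\<^esub> inv\<^bsub>Gam\<^esub> z ?k)"
    using gh k by (simp add: coboundary_def cl Gam.inv_mult_group Gam.m_assoc)
  also have "\<dots> = z g \<otimes>\<^bsub>Gam\<^esub> a g (z h) \<otimes>\<^bsub>Gam\<^esub> (f g \<otimes>\<^bsub>Gam\<^esub> a g (f h) \<otimes>\<^bsub>Gam\<^esub> inv\<^bsub>Gam\<^esub> f ?k \<otimes>\<^bsub>Gam\<^esub> inv\<^bsub>Gam\<^esub> z ?k)"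
    using gh k by (simp add: cl Gam.m_assoc Gam1_commute[OF az, of "f g"])
  also have "\<dots> = z g \<otimes>\<^bsub>Gam\<^esub> a g (z h) \<otimes>\<^bsub>Gam\<^esub> (inv\<^bsub>Gam\<^esub> z ?k \<otimes>\<^bsub>Gam\<^esub> (f g \<otimes>\<^bsub>Gam\<^esub> a g (f h) \<otimes>\<^bsub>Gam\<^esub> inv\<^bsub>Gam\<^esub> f ?k))"
    using gh k by (simp add: cl Gam1_commute[OF iz, symmetric])
  finally show ?thesis
    using gh k z1 a1_eq by (simp add: coboundary_def inv_A cl Gam.m_assoc)
qed

text \<open>The inverse built into \<open>Tra_cocycle\<close> cancels, which is why the criterion
  involves the inverse of the transgression.\<close>

lemma inv_Tra_cocycle_apply:
  assumes "f \<in> Hom_inv G G1 A (a1 \<circ> p)" "set_section G G0 p s" "x \<in> carrier G0" "y \<in> carrier G0"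
  shows "(inv\<^bsub>Z2 G0 A a1\<^esub> (Tra_cocycle G G0 A s f)) (x, y)
    = f (s x \<otimes>\<^bsub>G\<^esub> s y \<otimes>\<^bsub>G\<^esub> inv\<^bsub>G\<^esub> s (x \<otimes>\<^bsub>G0\<^esub> y))"
proof -
  have "f (s x \<otimes>\<^bsub>G\<^esub> s y \<otimes>\<^bsub>G\<^esub> inv\<^bsub>G\<^esub> s (x \<otimes>\<^bsub>G0\<^esub> y)) \<in> carrier A"
    using f_closed[OF assms(1) section_beta[OF assms]] by simp
  then show ?thesis
    using Z2_inv_apply[OF Tra_cocycle_in_Z2[OF assms(1,2)] assms(3,4)] assms(3,4)
    by (simp add: Tra_cocycle_def)
qed

text \<open>
  In the second direction \<open>s\<close> is not normalised: the value of the coboundary at \<open>(1, 1)\<close> gives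
  \<open>f 1 = \<pi>1 (s 1)\<close>, which is what makes the constructed cocycle restrict to \<open>\<pi>1\<close>.
\<close>

lemma ex_lift_iff:
  assumes \<pi>1: "\<pi>1 \<in> Hom_inv G G1 A (a1 \<circ> p)" and \<pi>0: "\<pi>0 \<in> Z1 G0 Gam0 a0"
    and s: "set_section G G0 p s"
  shows "(\<exists>\<pi>\<in>Z1 G Gam (a \<circ> p). lifts_pair G G1 p Gam1 q \<pi> \<pi>1 \<pi>0) \<longleftrightarrow>
    (\<exists>f. (\<forall>x\<in>carrier G0. f x \<in> carrier Gam \<and> q (f x) = \<pi>0 x) \<and>
      (\<forall>x\<in>carrier G0. \<forall>y\<in>carrier G0. coboundary G0 Gam a f (x, y)
        = \<pi>1 (s x \<otimes>\<^bsub>G\<^esub> s y \<otimes>\<^bsub>G\<^esub> inv\<^bsub>G\<^esub> s (x \<otimes>\<^bsub>G0\<^esub> y))))"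
    (is "?L \<longleftrightarrow> (\<exists>f. ?R f)")
proof
  have sc: "s x \<in> carrier G" "p (s x) = x" if "x \<in> carrier G0" for x
    using s that by (auto simp: set_section_def)
  define b where "b x y = s x \<otimes>\<^bsub>G\<^esub> s y \<otimes>\<^bsub>G\<^esub> inv\<^bsub>G\<^esub> s (x \<otimes>\<^bsub>G0\<^esub> y)" for x y
  have b: "b x y \<in> G1" if "x \<in> carrier G0" "y \<in> carrier G0" for x y
    using section_beta[OF \<pi>1 s that] by (simp add: b_def)
  have G1G: "n \<in> carrier G" "p n = \<one>\<^bsub>G0\<^esub>" if "n \<in> G1" for n
    using that by (simp_all add: in_G1)
  \<comment> \<open>The identity acts by an idempotent map; being injective, that map is the
    identity.\<close>
  have a_one: "a \<one>\<^bsub>G0\<^esub> x = x" if "x \<in> carrier Gam" for x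
  proof -
    have "a \<one>\<^bsub>G0\<^esub> (a \<one>\<^bsub>G0\<^esub> x) = a \<one>\<^bsub>G0\<^esub> x"
      using Gam_act(5)[of "\<one>\<^bsub>G0\<^esub>" "\<one>\<^bsub>G0\<^esub>" x] that by simp
    moreover have "a \<one>\<^bsub>G0\<^esub> \<in> Bij (carrier Gam)"
      using hom_in_carrier[OF a G0.one_closed] by (simp add: AutoGroup_def auto_def)
    ultimately show ?thesis
      using that Gam_act(1)[OF G0.one_closed that] by (auto simp: Bij_def bij_betw_def dest: inj_onD)
  qed
  show "\<exists>f. ?R f" if ?L
  proof -
    obtain \<pi> where \<pi>: "\<pi> \<in> Z1 G Gam (a \<circ> p)" and lift: "lifts_pair G G1 p Gam1 q \<pi> \<pi>1 \<pi>0"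
      using \<open>?L\<close> by blast
    have \<pi>c: "\<pi> g \<in> carrier Gam" "\<pi> (g \<otimes>\<^bsub>G\<^esub> h) = \<pi> g \<otimes>\<^bsub>Gam\<^esub> a (p g) (\<pi> h)"
      if "g \<in> carrier G" "h \<in> carrier G" for g h
      using \<pi> that by (auto simp: Z1_def)
    have "coboundary G0 Gam a (\<pi> \<circ> s) (x, y) = \<pi>1 (b x y)" if xy: "x \<in> carrier G0" "y \<in> carrier G0" for x y
    proof -
      have k: "x \<otimes>\<^bsub>G0\<^esub> y \<in> carrier G0" using xy by simp
      have "\<pi> (s x) \<otimes>\<^bsub>Gam\<^esub> a x (\<pi> (s y)) = \<pi> (s x \<otimes>\<^bsub>G\<^esub> s y)"
        using xy by (simp add: \<pi>c sc)
      also have "s x \<otimes>\<^bsub>G\<^esub> s y = b x y \<otimes>\<^bsub>G\<^esub> s (x \<otimes>\<^bsub>G0\<^esub> y)"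
        using xy by (simp add: b_def sc G.m_assoc)
      also have "\<pi> \<dots> = \<pi> (b x y) \<otimes>\<^bsub>Gam\<^esub> \<pi> (s (x \<otimes>\<^bsub>G0\<^esub> y))"
        using xy k G1G[OF b[OF xy]] by (simp add: \<pi>c sc a_one)
      finally have "coboundary G0 Gam a (\<pi> \<circ> s) (x, y) = \<pi> (b x y)"
        using xy k G1G[OF b[OF xy]] by (simp add: coboundary_def \<pi>c sc Gam.m_assoc)
      then show ?thesis
        using lift b[OF xy] by (simp add: lifts_pair_def)
    qed
    moreover have "\<pi> (s x) \<in> carrier Gam \<and> q (\<pi> (s x)) = \<pi>0 x" if "x \<in> carrier G0" for x
      using lift sc[OF that] \<pi>c(1)[of "s x" "s x"] by (auto simp: lifts_pair_def)
    ultimately show ?thesis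
      by (intro exI[of _ "\<pi> \<circ> s"]) (simp add: b_def)
  qed
  show ?L if "\<exists>f. ?R f"
  proof -
    obtain f where "?R f"
      using \<open>\<exists>f. ?R f\<close> ..
    then have f: "\<And>x. x \<in> carrier G0 \<Longrightarrow> f x \<in> carrier Gam"
      and qf: "\<And>x. x \<in> carrier G0 \<Longrightarrow> q (f x) = \<pi>0 x"
      and fb: "\<And>x y. \<lbrakk>x \<in> carrier G0; y \<in> carrier G0\<rbrakk> \<Longrightarrow> coboundary G0 Gam a f (x, y) = \<pi>1 (b x y)"
      by (auto simp: b_def)
    \<comment> \<open>The coboundary condition with the inverse cleared, ready for rewriting
      products.\<close>
    have ff: "f x \<otimes>\<^bsub>Gam\<^esub> a x (f y) = \<pi>1 (b x y) \<otimes>\<^bsub>Gam\<^esub> f (x \<otimes>\<^bsub>G0\<^esub> y)"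
      if "x \<in> carrier G0" "y \<in> carrier G0" for x y
      using that by (simp add: f Gam_act coboundary_def Gam.m_assoc flip: fb)
    \<comment> \<open>\<open>n g\<close> is the \<open>G1\<close> part of \<open>g\<close>, whose
      other factor is \<open>s (p g)\<close>.\<close>
    define n where "n g = g \<otimes>\<^bsub>G\<^esub> inv\<^bsub>G\<^esub> s (p g)" for g
    define \<pi> where "\<pi> = (\<lambda>g\<in>carrier G. \<pi>1 (n g) \<otimes>\<^bsub>Gam\<^esub> f (p g))"
    have n: "n g \<in> G1" if "g \<in> carrier G" for g
      using that by (simp add: n_def in_G1 sc)
    have \<pi>1c: "\<pi>1 m \<in> carrier Gam" "q (\<pi>1 m) = \<one>\<^bsub>Gam0\<^esub>" if "m \<in> G1" for m
      using f_closed[OF \<pi>1 that] by (simp_all add: in_Gam1)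
    have Gcancel: "inv\<^bsub>G\<^esub> x \<otimes>\<^bsub>G\<^esub> (x \<otimes>\<^bsub>G\<^esub> y) = y" if "x \<in> carrier G" "y \<in> carrier G" for x y
      using that by (simp flip: G.m_assoc)
    note G1_closed = subgroup.m_closed[OF G1]
    have mult: "\<pi> (g \<otimes>\<^bsub>G\<^esub> h) = \<pi> g \<otimes>\<^bsub>Gam\<^esub> a (p g) (\<pi> h)" if gh: "g \<in> carrier G" "h \<in> carrier G" for g h
    proof -
      let ?x = "p g" and ?y = "p h"
      have xy: "?x \<in> carrier G0" "?y \<in> carrier G0" using gh by simp_all
      \<comment> \<open>Moving \<open>n h\<close> to the left past \<open>s ?x\<close> conjugates
        it; invariance of \<open>\<pi>1\<close> turns this conjugation into the action of
        \<open>?x\<close>.\<close>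
      let ?m = "s ?x \<otimes>\<^bsub>G\<^esub> n h \<otimes>\<^bsub>G\<^esub> inv\<^bsub>G\<^esub> s ?x"
      have m: "?m \<in> G1" "\<pi>1 ?m = a ?x (\<pi>1 (n h))"
        using f_conj[OF \<pi>1 sc(1)[OF xy(1)] n[OF gh(2)]] sc xy f_closed[OF \<pi>1 n[OF gh(2)]] a1_eq by simp_all
      have am: "a ?x (\<pi>1 (n h)) \<in> Gam1"
        using Gam_act_Gam1[OF xy(1) f_closed[OF \<pi>1 n[OF gh(2)]]] .
      have "n (g \<otimes>\<^bsub>G\<^esub> h) = n g \<otimes>\<^bsub>G\<^esub> ?m \<otimes>\<^bsub>G\<^esub> b ?x ?y"
        using gh xy by (simp add: n_def b_def sc G.m_assoc Gcancel)
      then have "\<pi>1 (n (g \<otimes>\<^bsub>G\<^esub> h)) = \<pi>1 (n g) \<otimes>\<^bsub>Gam\<^esub> a ?x (\<pi>1 (n h)) \<otimes>\<^bsub>Gam\<^esub> \<pi>1 (b ?x ?y)"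
        using gh xy m by (simp add: f_mult[OF \<pi>1] n b G1_closed)
      \<comment> \<open>By \<open>ff\<close>, the factor \<open>\<pi>1 (b ?x ?y)\<close> and the
        value of \<open>f\<close> at the product recombine into \<open>f ?x\<close> times the
        translate of \<open>f ?y\<close>.\<close>
      then have "\<pi> (g \<otimes>\<^bsub>G\<^esub> h) = \<pi>1 (n g) \<otimes>\<^bsub>Gam\<^esub> (a ?x (\<pi>1 (n h)) \<otimes>\<^bsub>Gam\<^esub> f ?x) \<otimes>\<^bsub>Gam\<^esub> a ?x (f ?y)"
        using gh xy by (simp add: \<pi>_def \<pi>1c n b f Gam_act Gam.m_assoc ff)
      also have "\<dots> = \<pi>1 (n g) \<otimes>\<^bsub>Gam\<^esub> (f ?x \<otimes>\<^bsub>Gam\<^esub> a ?x (\<pi>1 (n h))) \<otimes>\<^bsub>Gam\<^esub> a ?x (f ?y)"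
        using Gam1_commute[OF am f[OF xy(1)]] by simp
      finally show ?thesis
        using gh xy by (simp add: \<pi>_def \<pi>1c n f Gam_act Gam.m_assoc)
    qed
    have "\<pi> \<in> Z1 G Gam (a \<circ> p)"
      using mult by (auto simp: Z1_def \<pi>_def \<pi>1c n f)
    moreover have "\<pi> m = \<pi>1 m" if m: "m \<in> G1" for m
    proof -
      let ?s = "s \<one>\<^bsub>G0\<^esub>"
      \<comment> \<open>At the pair of identities \<open>ff\<close> has the same factor
        \<open>f 1\<close> on the right of both sides; it cancels.\<close>
      have "f \<one>\<^bsub>G0\<^esub> = \<pi>1 (b \<one>\<^bsub>G0\<^esub> \<one>\<^bsub>G0\<^esub>)"
        using ff[of "\<one>\<^bsub>G0\<^esub>" "\<one>\<^bsub>G0\<^esub>"] f[of "\<one>\<^bsub>G0\<^esub>"] by (simp add: a_one \<pi>1c b)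
      also have "b \<one>\<^bsub>G0\<^esub> \<one>\<^bsub>G0\<^esub> = ?s"
        by (simp add: b_def sc G.m_assoc)
      finally have "\<pi> m = \<pi>1 (n m) \<otimes>\<^bsub>Gam\<^esub> \<pi>1 ?s"
        using G1G[OF m] by (simp add: \<pi>_def)
      also have "\<dots> = \<pi>1 (n m \<otimes>\<^bsub>G\<^esub> ?s)"
        using f_mult[OF \<pi>1 n[OF G1G(1)[OF m]], of ?s] by (simp add: in_G1 sc)
      also have "n m \<otimes>\<^bsub>G\<^esub> ?s = m"
        using G1G[OF m] by (simp add: n_def sc G.m_assoc)
      finally show ?thesis .
    qed
    moreover have "\<pi>0 (p g) = q (\<pi> g)" if "g \<in> carrier G" for g
      using that qf[of "p g"] q.hom_closed[OF f[of "p g"]] by (simp add: \<pi>_def \<pi>1c n f)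
    ultimately show ?L
      using f_closed[OF \<pi>1] by (intro bexI[of _ \<pi>]) (auto simp: lifts_pair_def)
  qed
qed

text \<open>\<open>ex_lift_iff\<close> demands equality of cochains for some lift of
  \<open>\<pi>0\<close>, while the cohomological condition compares classes for one fixed lift. The
  freedom to change the lift by a \<open>Gam1\<close>-valued cochain bridges the two.\<close>

lemma lift_iff_inv_Tra_eq_Delta:
  assumes \<pi>1: "\<pi>1 \<in> Hom_inv G G1 A (a1 \<circ> p)" and \<pi>0: "\<pi>0 \<in> Z1 G0 Gam0 a0"
  shows "(\<exists>\<pi>\<in>Z1 G Gam (a \<circ> p). lifts_pair G G1 p Gam1 q \<pi> \<pi>1 \<pi>0) \<longleftrightarrow>
    inv\<^bsub>H2 G0 A a1\<^esub> (Tra G G0 p A a1 \<pi>1) = Delta G0 Gam Gam0 q Gam1 a a1 (H1_class G0 Gam0 a0 \<pi>0)"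
proof -
  obtain s t where s: "set_section G G0 p s" and t: "set_section Gam Gam0 q t"
    using ex_section_p ex_section_q by blast
  define c where "c = inv\<^bsub>Z2 G0 A a1\<^esub> (Tra_cocycle G G0 A s \<pi>1)"
  have c: "c \<in> carrier (Z2 G0 A a1)"
    using Tra_cocycle_in_Z2[OF \<pi>1 s] by (simp add: c_def)
  have c_eq: "c (x, y) = \<pi>1 (s x \<otimes>\<^bsub>G\<^esub> s y \<otimes>\<^bsub>G\<^esub> inv\<^bsub>G\<^esub> s (x \<otimes>\<^bsub>G0\<^esub> y))"
    if "x \<in> carrier G0" "y \<in> carrier G0" for x y
    using inv_Tra_cocycle_apply[OF \<pi>1 s that] by (simp add: c_def)
  \<comment> \<open>The reference lift: its coboundary is the cocycle defining
    \<open>Delta\<close>.\<close>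
  define f0 where "f0 = t \<circ> \<pi>0"
  have f0: "f0 x \<in> carrier Gam \<and> q (f0 x) = \<pi>0 x" if "x \<in> carrier G0" for x
    using t \<pi>0 that by (auto simp: f0_def set_section_def Z1_def PiE_iff)
  have lifts: "(\<exists>\<pi>\<in>Z1 G Gam (a \<circ> p). lifts_pair G G1 p Gam1 q \<pi> \<pi>1 \<pi>0) \<longleftrightarrow>
    (\<exists>f. (\<forall>x\<in>carrier G0. f x \<in> carrier Gam \<and> q (f x) = \<pi>0 x) \<and>
      (\<forall>x\<in>carrier G0. \<forall>y\<in>carrier G0. coboundary G0 Gam a f (x, y) = c (x, y)))"
    unfolding ex_lift_iff[OF assms s] by (simp add: c_eq)
  have classes: "inv\<^bsub>H2 G0 A a1\<^esub> (Tra G G0 p A a1 \<pi>1) = H2_class G0 A a1 c"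
    "Delta G0 Gam Gam0 q Gam1 a a1 (H1_class G0 Gam0 a0 \<pi>0) = H2_class G0 A a1 (coboundary G0 Gam a f0)"
    using Tra_eq[OF \<pi>1 s] inv_H2_class[OF Tra_cocycle_in_Z2[OF \<pi>1 s]] Delta_eq[OF t \<pi>0]
    by (simp_all add: c_def f0_def Delta_cocycle_coboundary)
  show ?thesis
    unfolding lifts classes
  proof
    assume "\<exists>f. (\<forall>x\<in>carrier G0. f x \<in> carrier Gam \<and> q (f x) = \<pi>0 x) \<and>
      (\<forall>x\<in>carrier G0. \<forall>y\<in>carrier G0. coboundary G0 Gam a f (x, y) = c (x, y))"
    then obtain f where f: "\<And>x. x \<in> carrier G0 \<Longrightarrow> f x \<in> carrier Gam \<and> q (f x) = \<pi>0 x"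
      and fc: "\<And>x y. \<lbrakk>x \<in> carrier G0; y \<in> carrier G0\<rbrakk> \<Longrightarrow> coboundary G0 Gam a f (x, y) = c (x, y)"
      by blast
    \<comment> \<open>Both functions are \<open>undefined\<close> off the carrier, so agreement on
      pairs from \<open>G0\<close> gives equality.\<close>
    have "coboundary G0 Gam a f = c"
      using fc by (intro Z2_ext Z2_extensional[OF c]) (simp_all add: coboundary_def)
    then show "H2_class G0 A a1 c = H2_class G0 A a1 (coboundary G0 Gam a f0)"
      using coboundary_lift_class[OF Z1_rel_refl[OF \<pi>0] f0 f] by simp
  next
    assume "H2_class G0 A a1 c = H2_class G0 A a1 (coboundary G0 Gam a f0)"
    then obtain z where z: "z \<in> carrier G0 \<rightarrow> carrier A"
      and cz: "\<And>x y. \<lbrakk>x \<in> carrier G0; y \<in> carrier G0\<rbrakk> \<Longrightarrow>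
        c (x, y) = coboundary G0 A a1 z (x, y) \<otimes>\<^bsub>A\<^esub> coboundary G0 Gam a f0 (x, y)"
      using H2_class_eqD[OF c] by metis
    \<comment> \<open>The corrected lift will be \<open>z\<close> times \<open>f0\<close>. It still
      lifts \<open>\<pi>0\<close> because \<open>q\<close> kills \<open>z\<close>, and
      \<open>cz\<close> identifies its coboundary with \<open>c\<close>.\<close>
    have "z x \<in> carrier Gam \<and> q (z x) = \<one>\<^bsub>Gam0\<^esub>" if "x \<in> carrier G0" for x
      using z that by (auto simp: in_Gam1)
    moreover have "\<pi>0 x \<in> carrier Gam0" if "x \<in> carrier G0" for x
      using \<pi>0 that by (auto simp: Z1_def)
    moreover have "f0 \<in> carrier G0 \<rightarrow> carrier Gam"
      using f0 by auto
    ultimately show "\<exists>f. (\<forall>x\<in>carrier G0. f x \<in> carrier Gam \<and> q (f x) = \<pi>0 x) \<and>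
      (\<forall>x\<in>carrier G0. \<forall>y\<in>carrier G0. coboundary G0 Gam a f (x, y) = c (x, y))"
      using z f0 by (intro exI[of _ "\<lambda>x. z x \<otimes>\<^bsub>Gam\<^esub> f0 x"]) (simp add: coboundary_mult_Gam1 cz)
  qed
qed

end

theorem lemma3p1:
  fixes G :: "('g, 'x) monoid_scheme" and G0 :: "('h, 'y) monoid_scheme"
    and Gam :: "('m, 'z) monoid_scheme" and Gam0 :: "('n, 'w) monoid_scheme"
    and G1 :: "'g set" and Gam1 :: "'m set"
    and p :: "'g \<Rightarrow> 'h" and q :: "'m \<Rightarrow> 'n"
    and a :: "'h \<Rightarrow> 'm \<Rightarrow> 'm" and a1 :: "'h \<Rightarrow> 'm \<Rightarrow> 'm" and a0 :: "'h \<Rightarrow> 'n \<Rightarrow> 'n"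
    and \<pi>1 :: "'g \<Rightarrow> 'm" and \<pi>0 :: "'h \<Rightarrow> 'n"
  assumes "group G" and "group G0"
    and "p \<in> epi G G0" and "kernel G G0 p = G1"
    and "group Gam" and "group Gam0"
    and "q \<in> epi Gam Gam0" and "kernel Gam Gam0 q = Gam1"
    and "\<forall>z\<in>Gam1. \<forall>x\<in>carrier Gam. z \<otimes>\<^bsub>Gam\<^esub> x = x \<otimes>\<^bsub>Gam\<^esub> z"
    and "a1 \<in> hom G0 (AutoGroup (Gam\<lparr>carrier := Gam1\<rparr>))"
    and "a \<in> hom G0 (AutoGroup Gam)"
    and "a0 \<in> hom G0 (AutoGroup Gam0)"
    and "\<forall>g\<in>carrier G0. \<forall>z\<in>Gam1. a1 g z = a g z"
    and "\<forall>g\<in>carrier G0. \<forall>x\<in>carrier Gam. q (a g x) = a0 g (q x)"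
    and "\<pi>1 \<in> Hom_inv G G1 (Gam\<lparr>carrier := Gam1\<rparr>) (a1 \<circ> p)"
    and "\<pi>0 \<in> Z1 G0 Gam0 a0"
  shows "(\<exists>\<pi>\<in>Z1 G Gam (a \<circ> p). lifts_pair G G1 p Gam1 q \<pi> \<pi>1 \<pi>0) \<longleftrightarrow>
    inv\<^bsub>H2 G0 (Gam\<lparr>carrier := Gam1\<rparr>) a1\<^esub> (Tra G G0 p (Gam\<lparr>carrier := Gam1\<rparr>) a1 \<pi>1)
      = Delta G0 Gam Gam0 q Gam1 a a1 (H1_class G0 Gam0 a0 \<pi>0)"
proof -
  interpret two_extensions G G0 Gam Gam0 G1 Gam1 p q a a1 a0
    using assms by (simp add: two_extensions_def two_extensions_axioms_def)
  show ?thesis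
    using assms(15,16) by (rule lift_iff_inv_Tra_eq_Delta)
qed

end
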